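(* Let $n$ be even and let $G$ be a finite connected graph with a harmonic action of $D_n=\langle\sigma_1,\sigma_2\rangle$ as described in the context, with vertices labeled $z_i^j$ ($1\le j\le s$) and $x_i^j,y_i^j$ ($1\le j\le t$), $i\in\{1,\dots,n\}$. Let $\delta$ be a divisor of degree zero on $G$. Then $\delta\in\mathcal{P}=\mathcal{P}_1+\mathcal{P}_2+\mathcal{P}_3$ if and only if: (1) $\sum_{i=1}^n i\,(X_i+Y_i+Z_i)\equiv 0\pmod n$, where $X_i=\sum_{j=1}^t\delta(x_i^j)$, $Y_i=\sum_{j=1}^t\delta(y_i^j)$, $Z_i=\sum_{j=1}^s\delta(z_i^j)$; (2) for each $j=1,\dots,t$, $\sum_{i=1}^n\delta(x_i^j)\equiv\sum_{i=1}^n\delta(y_i^j)\pmod n$; and (3) for each $j=1,\dots,s$, $\sum_{i=1}^n\delta(z_i^j)\equiv 0\pmod 2$.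
   Context: Graphs are finite, connected, may have multiple edges, no loops. A divisor on $G$ is a function from the vertex set to $\mathbb{Z}$; its degree is the sum of its values. Setting: $D_n$ is the dihedral group of order $2n$ generated by involutions $\sigma_1,\sigma_2$, acting on $G$ by automorphisms harmonically (no non-identity element fixes both endpoints of an edge), and every $D_n$-orbit of vertices has $n$ or $2n$ points. The vertices are labeled so that there are $s$ orbits of size $n$, $\{z_i^j: i=1,\dots,n\}$ for $j=1,\dots,s$, and $t$ orbits of size $2n$, $\{x_i^j,y_i^j\}$ for $j=1,\dots,t$, with (subscripts mod $n$) $\sigma_1(z_i^j)=z_{n+1-i}^j$, $\sigma_1(x_i^j)=y_{n+1-i}^j$, $\sigma_1(y_i^j)=x_{n+1-i}^j$, $\sigma_2(z_i^j)=z_{n+2-i}^j$, $\sigma_2(x_i^j)=y_{n+2-i}^j$, $\sigma_2(y_i^j)=x_{n+2-i}^j$. For a subgroup $\Gamma$ the quotient graph $G/\Gamma$ has vertices the $\Gamma$-orbits of vertices and edges the $\Gamma$-orbits of edges, quotient map $\phi$; the pullback of a divisor $\hat D$ on $G/\Gamma$ is $\phi^*(\hat D)(v)=|\mathrm{Stab}_\Gamma(v)|\,\hat D(\phi(v))$. Let $H_1=G/\langle\sigma_1\rangle$, $H_2=G/\langle\sigma_2\rangle$, $H_3=G/\langle\sigma_1\sigma_2\rangle$, let $\mathcal{P}_k$ be the set of divisors $\phi_k^*(\hat D)$ with $\hat D$ of degree zero on $H_k$, and $\mathcal{P}_1+\mathcal{P}_2+\mathcal{P}_3$ the set of sums $\delta_1+\delta_2+\delta_3$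 with $\delta_k\in\mathcal{P}_k$.
   Formalization: The formal statement assumes at least one orbit of size n (s ≥ 1); for s = 0 the equivalence fails, e.g. on the Cayley 2n-cycle of D_n with δ = (n/2)(x_n − y_n), which satisfies (1)–(3) but is not in P. *)

theory Defs
  imports "HOL-Algebra.Algebra" "HOL-Number_Theory.Cong"
begin

section \<open>Multigraphs and divisors\<close>

record ('v, 'e) multigraph =
  verts :: "'v set"
  edges :: "'e set"
  ends :: "'e \<Rightarrow> 'v set"

definition adjacency :: "('v, 'e) multigraph \<Rightarrow> ('v \<times> 'v) set" where
  "adjacency G = {(u, v). \<exists>e \<in> edges G. ends G e = {u, v}}"

text \<open>Requiring two distinct ends excludes loops; multiple edges are allowed.\<close>

locale connected_multigraph =
  fixes G :: "('v, 'e) multigraph"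
  assumes finite_verts: "finite (verts G)"
    and finite_edges: "finite (edges G)"
    and verts_nonempty: "verts G \<noteq> {}"
    and ends_in_verts: "e \<in> edges G \<Longrightarrow> ends G e \<subseteq> verts G"
    and two_ends: "e \<in> edges G \<Longrightarrow> card (ends G e) = 2"
    and connected: "\<lbrakk>u \<in> verts G; v \<in> verts G\<rbrakk> \<Longrightarrow> (u, v) \<in> (adjacency G)\<^sup>*"

text \<open>A divisor is an integer function on the vertex set, extended by zero to the whole type.\<close>

definition divisors :: "('v, 'e) multigraph \<Rightarrow> ('v \<Rightarrow> int) set" where
  "divisors G = {D. \<forall>v. v \<notin> verts G \<longrightarrow> D v = 0}"

definition div_degree :: "('v, 'e) multigraph \<Rightarrow> ('v \<Rightarrow> int) \<Rightarrow> int" where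
  "div_degree G D = (\<Sum>v \<in> verts G. D v)"

section \<open>Harmonic actions, quotients and pullbacks\<close>

locale harmonic_action =
  connected_multigraph G +
  on_verts: group_action A "verts G" av +
  on_edges: group_action A "edges G" ae
  for G :: "('v, 'e) multigraph" and A :: "'g monoid"
    and av :: "'g \<Rightarrow> 'v \<Rightarrow> 'v" and ae :: "'g \<Rightarrow> 'e \<Rightarrow> 'e" +
  assumes automorphism:
      "\<lbrakk>g \<in> carrier A; e \<in> edges G\<rbrakk> \<Longrightarrow> ends G (ae g e) = av g ` ends G e"
    and harmonic:
      "\<lbrakk>g \<in> carrier A; g \<noteq> \<one>\<^bsub>A\<^esub>; e \<in> edges G\<rbrakk> \<Longrightarrow> \<not> (\<forall>v \<in> ends G e. av g v = v)"

definition subgroup_generated_by :: "'g monoid \<Rightarrow> 'g \<Rightarrow> 'g monoid" where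
  "subgroup_generated_by A g = A\<lparr>carrier := generate A {g}\<rparr>"

text \<open>An edge whose ends lie in one orbit becomes a loop of the quotient
  (its set of ends is then a singleton).\<close>

definition quotient_graph ::
  "('v, 'e) multigraph \<Rightarrow> 'g monoid \<Rightarrow> ('g \<Rightarrow> 'v \<Rightarrow> 'v) \<Rightarrow> ('g \<Rightarrow> 'e \<Rightarrow> 'e)
    \<Rightarrow> ('v set, 'e set) multigraph" where
  "quotient_graph G K av ae =
    \<lparr>verts = orbits K (verts G) av,
     edges = orbits K (edges G) ae,
     ends = (\<lambda>E. orbit K av ` (\<Union>e \<in> E. ends G e))\<rparr>"

definition pullback ::
  "('v, 'e) multigraph \<Rightarrow> 'g monoid \<Rightarrow> ('g \<Rightarrow> 'v \<Rightarrow> 'v) \<Rightarrow> ('v set \<Rightarrow> int) \<Rightarrow> 'v \<Rightarrow> int" where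
  "pullback G K av D =
    (\<lambda>v. if v \<in> verts G then int (card (stabilizer K av v)) * D (orbit K av v) else 0)"

definition pullbacks0 ::
  "('v, 'e) multigraph \<Rightarrow> 'g monoid \<Rightarrow> ('g \<Rightarrow> 'v \<Rightarrow> 'v) \<Rightarrow> ('g \<Rightarrow> 'e \<Rightarrow> 'e)
    \<Rightarrow> ('v \<Rightarrow> int) set" where
  "pullbacks0 G K av ae =
    {pullback G K av D | D.
      D \<in> divisors (quotient_graph G K av ae) \<and> div_degree (quotient_graph G K av ae) D = 0}"

definition sum3 :: "('v \<Rightarrow> int) set \<Rightarrow> ('v \<Rightarrow> int) set \<Rightarrow> ('v \<Rightarrow> int) set \<Rightarrow> ('v \<Rightarrow> int) set" where
  "sum3 P1 P2 P3 =
    {(\<lambda>v. d1 v + d2 v + d3 v) | d1 d2 d3. d1 \<in> P1 \<and> d2 \<in> P2 \<and> d3 \<in> P3}"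

section \<open>Dihedral actions with labelled vertices\<close>

text \<open>A group of order \<open>2 n\<close> generated by two involutions is dihedral.\<close>

locale dihedral_group = group A for A :: "'g monoid" +
  fixes n :: nat and \<sigma>1 \<sigma>2 :: 'g
  assumes n_pos: "0 < n"
    and order_dihedral: "order A = 2 * n"
    and sigma_carrier: "\<sigma>1 \<in> carrier A" "\<sigma>2 \<in> carrier A"
    and sigma_nontrivial: "\<sigma>1 \<noteq> \<one>\<^bsub>A\<^esub>" "\<sigma>2 \<noteq> \<one>\<^bsub>A\<^esub>"
    and sigma_involution: "\<sigma>1 \<otimes>\<^bsub>A\<^esub> \<sigma>1 = \<one>\<^bsub>A\<^esub>" "\<sigma>2 \<otimes>\<^bsub>A\<^esub> \<sigma>2 = \<one>\<^bsub>A\<^esub>"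
    and sigma_generate: "generate A {\<sigma>1, \<sigma>2} = carrier A"

text \<open>The vertex \<open>z i j\<close> is $z_i^j$. The subscript \<open>i\<close> is read modulo \<open>n\<close>:
  it ranges over all integers and the labels are \<open>n\<close>-periodic in it,
  with \<open>{1..n}\<close> as a system of representatives.\<close>

locale labelled_dihedral_action =
  harmonic_action G A av ae + dihedral_group A n \<sigma>1 \<sigma>2
  for G :: "('v, 'e) multigraph" and A :: "'g monoid"
    and av :: "'g \<Rightarrow> 'v \<Rightarrow> 'v" and ae :: "'g \<Rightarrow> 'e \<Rightarrow> 'e"
    and n :: nat and \<sigma>1 \<sigma>2 :: 'g +
  fixes s t :: nat and z x y :: "int \<Rightarrow> nat \<Rightarrow> 'v"
  assumes orbit_sizes: "Q \<in> orbits A (verts G) av \<Longrightarrow> card Q = n \<or> card Q = 2 * n"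
    and periodic:
      "j \<in> {1..s} \<Longrightarrow> z (i + int n) j = z i j"
      "j \<in> {1..t} \<Longrightarrow> x (i + int n) j = x i j"
      "j \<in> {1..t} \<Longrightarrow> y (i + int n) j = y i j"
    and labels_inj:
      "inj_on (\<lambda>(i, j). z i j) ({1..int n} \<times> {1..s})"
      "inj_on (\<lambda>(i, j). x i j) ({1..int n} \<times> {1..t})"
      "inj_on (\<lambda>(i, j). y i j) ({1..int n} \<times> {1..t})"
    and labels_disjoint:
      "\<lbrakk>j \<in> {1..s}; k \<in> {1..t}\<rbrakk> \<Longrightarrow> z i j \<noteq> x l k"
      "\<lbrakk>j \<in> {1..s}; k \<in> {1..t}\<rbrakk> \<Longrightarrow> z i j \<noteq> y l k"
      "\<lbrakk>j \<in> {1..t}; k \<in> {1..t}\<rbrakk> \<Longrightarrow> x i j \<noteq> y l k"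
    and labels_verts:
      "verts G = {z i j | i j. i \<in> {1..int n} \<and> j \<in> {1..s}}
        \<union> {x i j | i j. i \<in> {1..int n} \<and> j \<in> {1..t}}
        \<union> {y i j | i j. i \<in> {1..int n} \<and> j \<in> {1..t}}"
    and labels_orbits:
      "j \<in> {1..s} \<Longrightarrow> {z i j | i. i \<in> {1..int n}} \<in> orbits A (verts G) av"
      "j \<in> {1..t} \<Longrightarrow>
        {x i j | i. i \<in> {1..int n}} \<union> {y i j | i. i \<in> {1..int n}} \<in> orbits A (verts G) av"
    and sigma1_labels:
      "j \<in> {1..s} \<Longrightarrow> av \<sigma>1 (z i j) = z (int n + 1 - i) j"
      "j \<in> {1..t} \<Longrightarrow> av \<sigma>1 (x i j) = y (int n + 1 - i) j"
      "j \<in> {1..t} \<Longrightarrow> av \<sigma>1 (y i j) = x (int n + 1 - i) j"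
    and sigma2_labels:
      "j \<in> {1..s} \<Longrightarrow> av \<sigma>2 (z i j) = z (int n + 2 - i) j"
      "j \<in> {1..t} \<Longrightarrow> av \<sigma>2 (x i j) = y (int n + 2 - i) j"
      "j \<in> {1..t} \<Longrightarrow> av \<sigma>2 (y i j) = x (int n + 2 - i) j"

end

theory Submission
  imports Defs "HOL-Library.Function_Algebras"
begin

text \<open>A pullback from the quotient by \<open>K\<close> is \<open>K\<close>-invariant, and its sum over a \<open>K\<close>-stable set of
  vertices is \<open>|K|\<close> times the sum of the divisor it comes from. This gives the necessity of the three
  conditions, after reflecting the index in the first moment \<open>\<Sum>i (X\<^sub>i + Y\<^sub>i + Z\<^sub>i)\<close>.

  Conversely, compute modulo \<open>\<P>\<close>. All sums \<open>v + \<sigma>\<^sub>1 v\<close> agree, say with \<open>a\<close>, and all sums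
  \<open>v + \<sigma>\<^sub>2 v\<close> agree, say with \<open>b\<close>; so raising the index of any vertex by one adds \<open>R = b - a\<close>,
  and \<open>n R = 0\<close> by periodicity. Hence a divisor is the sum of its rows concentrated at index \<open>0\<close> plus its
  moment times \<open>R\<close>. With \<open>T = a - R\<close> one has \<open>2 z\<^sub>0 = T\<close> and \<open>x\<^sub>0 + y\<^sub>0 = T\<close>, and
  comparing rotation orbits gives \<open>n x\<^sub>0 = n z\<^sub>0 = (n/2) T\<close>. Under the three conditions the divisor is
  therefore half its degree times \<open>T\<close>, which is zero.\<close>

lemma sum_fun_apply: "(sum f A) u = (\<Sum>a\<in>A. f a u)"
  by (induction A rule: infinite_finite_induct) auto

text \<open>Divisors live in the pointwise ring of integer functions. There \<open>of_int k\<close>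
  is the constant function, so \<open>of_int k * f\<close> is an integer multiple of a
  divisor.\<close>

lemma of_int_fun_apply: "(of_int k :: 'a \<Rightarrow> int) u = k"
  by (cases k) (simp_all add: fun_Compl_def)

section \<open>Orbits, stabilizers and stabilizer-weighted sums\<close>

context group_action
begin

lemma orbit_eqI:
  assumes "x \<in> E" "g \<in> carrier G"
  shows "orbit G \<phi> (\<phi> g x) = orbit G \<phi> x"
proof -
  have "\<phi> g x \<in> E" "\<phi> g x \<in> orbit G \<phi> x"
    using assms element_image by (auto simp: orbit_def)
  then show ?thesis
    using assms disjoint_union[of "orbit G \<phi> x" "orbit G \<phi> (\<phi> g x)"] orbit_refl
    unfolding orbits_def by blast
qed

text \<open>Both points have the same orbit, so the orbit-stabilizer theorem gives equal products,
  and the finite nonempty orbit cancels. Hence the weights in a pullback are constant on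
  orbits.\<close>

lemma card_stabilizer_translate:
  assumes "finite (carrier G)" "x \<in> E" "g \<in> carrier G"
  shows "card (stabilizer G \<phi> (\<phi> g x)) = card (stabilizer G \<phi> x)"
proof -
  have E: "\<phi> g x \<in> E"
    using assms element_image by auto
  have "card (orbit G \<phi> x) * card (stabilizer G \<phi> (\<phi> g x)) = card (orbit G \<phi> x) * card (stabilizer G \<phi> x)"
    using orbit_stabilizer_theorem[OF E] orbit_stabilizer_theorem[OF assms(2)] orbit_eqI[OF assms(2,3)]
    by simp
  moreover have "finite (orbit G \<phi> x)" "orbit G \<phi> x \<noteq> {}"
    using assms by (auto simp: orbit_def)
  ultimately show ?thesis
    by simp
qed

text \<open>If some \<open>k\<close> carries \<open>x\<close> to \<open>u\<close>, the elements
  doing so form a coset of the stabilizer of \<open>u\<close>. This turns a sum over group elements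
  into the multiplicities that \<open>pullback\<close> prescribes.\<close>

lemma card_transporter:
  assumes "x \<in> E" "u \<in> E"
  shows "card {g \<in> carrier G. \<phi> g x = u}
    = (if orbit G \<phi> u = orbit G \<phi> x then card (stabilizer G \<phi> u) else 0)"
proof (cases "u \<in> orbit G \<phi> x")
  case True
  interpret group G
    using group_hom group_hom.axioms(1) by auto
  obtain k where k: "k \<in> carrier G" "\<phi> k x = u"
    using True by (auto simp: orbit_def)
  have "bij_betw (\<lambda>g. g \<otimes> k) (stabilizer G \<phi> u) {g \<in> carrier G. \<phi> g x = u}"
    using k assms orbit_sym_aux[OF k(1) assms(1) k(2)]
    by (intro bij_betwI[where g = "\<lambda>g. g \<otimes> inv k"])
      (auto simp: stabilizer_def composition_rule m_assoc)
  then show ?thesis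
    using orbit_eqI[OF assms(1) k(1)] k(2) bij_betw_same_card by force
next
  case False
  then have "{g \<in> carrier G. \<phi> g x = u} = {}"
    by (auto simp: orbit_def)
  moreover have "orbit G \<phi> u \<noteq> orbit G \<phi> x"
    using False orbit_refl[OF assms(2)] by auto
  ultimately show ?thesis
    by (simp only: card.empty if_False)
qed

text \<open>Split \<open>S\<close> into orbits; on each of them the stabilizer orders add up to the
  group order. Allowing any stable \<open>S\<close> covers both the degree over all vertices and the
  divisibility on a single row of labels.\<close>

lemma sum_stabilizer_weighted:
  fixes D :: "'c set \<Rightarrow> int"
  assumes fin: "finite (carrier G)" "finite S" and S: "S \<subseteq> E"
    and closed: "\<And>g x. g \<in> carrier G \<Longrightarrow> x \<in> S \<Longrightarrow> \<phi> g x \<in> S"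
  shows "(\<Sum>x\<in>S. int (card (stabilizer G \<phi> x)) * D (orbit G \<phi> x))
    = int (order G) * (\<Sum>Q\<in>orbits G S \<phi>. D Q)"
proof -
  have orbits: "orbits G S \<phi> = orbit G \<phi> ` S"
    by (auto simp: orbits_def)
  have fibre: "{x \<in> S. orbit G \<phi> x = Q} = Q" if Q: "Q \<in> orbits G S \<phi>" for Q
  proof -
    obtain v where v: "v \<in> S" "Q = orbit G \<phi> v"
      using Q by (auto simp: orbits_def)
    have "x \<in> Q" if "x \<in> S" "orbit G \<phi> x = Q" for x
      using that orbit_refl S by blast
    moreover have "x \<in> S \<and> orbit G \<phi> x = Q" if x: "x \<in> Q" for x
    proof -
      obtain g where "g \<in> carrier G" "x = \<phi> g v"
        using x v(2) by (auto simp: orbit_def)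
      then show ?thesis
        using v closed S orbit_eqI by blast
    qed
    ultimately show ?thesis
      by blast
  qed
  have "(\<Sum>x\<in>S. int (card (stabilizer G \<phi> x)) * D (orbit G \<phi> x))
      = (\<Sum>Q\<in>orbits G S \<phi>. \<Sum>x\<in>{x \<in> S. orbit G \<phi> x = Q}.
          int (card (stabilizer G \<phi> x)) * D (orbit G \<phi> x))"
    using fin by (intro sum.group[symmetric]) (auto simp: orbits)
  also have "\<dots> = (\<Sum>Q\<in>orbits G S \<phi>. int (order G) * D Q)"
  proof (rule sum.cong[OF refl])
    fix Q assume Q: "Q \<in> orbits G S \<phi>"
    have "(\<Sum>x\<in>{x \<in> S. orbit G \<phi> x = Q}. int (card (stabilizer G \<phi> x)) * D (orbit G \<phi> x))
        = (\<Sum>x\<in>{x \<in> S. orbit G \<phi> x = Q}. int (card (stabilizer G \<phi> x))) * D Q"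
      by (simp add: sum_distrib_right)
    also have "\<dots> = int (\<Sum>x\<in>Q. card (stabilizer G \<phi> x)) * D Q"
      using fibre[OF Q] by simp
    also have "(\<Sum>x\<in>Q. card (stabilizer G \<phi> x)) = order G"
      using Q S fin(1) by (intro card_stablizer_sum) (auto simp: orbits_def)
    finally show "(\<Sum>x\<in>{x \<in> S. orbit G \<phi> x = Q}.
        int (card (stabilizer G \<phi> x)) * D (orbit G \<phi> x)) = int (order G) * D Q" .
  qed
  finally show ?thesis
    by (simp add: sum_distrib_left)
qed

end

section \<open>Pullbacks under a finite group action\<close>

definition point_divisor :: "'v \<Rightarrow> 'v \<Rightarrow> int" where
  "point_divisor v = (\<lambda>u. if u = v then 1 else 0)"

lemma sum_point_divisors:
  assumes "finite V" "\<And>u. u \<notin> V \<Longrightarrow> D u = 0"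
  shows "(\<Sum>v\<in>V. of_int (D v) * point_divisor v) = D"
  using assms by (auto simp: fun_eq_iff sum_fun_apply point_divisor_def of_int_fun_apply
      if_distrib sum.delta cong: if_cong)

locale finite_vertex_action =
  group_action K "verts G" av
  for G :: "('v, 'e) multigraph" and K :: "'g monoid" and av :: "'g \<Rightarrow> 'v \<Rightarrow> 'v" +
  assumes finite_group: "finite (carrier K)"
    and finite_vertices: "finite (verts G)"
begin

lemma pullbacks0_invariant:
  assumes "f \<in> pullbacks0 G K av ae" "v \<in> verts G" "k \<in> carrier K"
  shows "f (av k v) = f v"
  using assms element_image orbit_eqI card_stabilizer_translate[OF finite_group]
  by (auto simp: pullbacks0_def pullback_def)

lemma pullbacks0_sum_dvd:
  assumes f: "f \<in> pullbacks0 G K av ae" and S: "S \<subseteq> verts G"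
    and closed: "\<And>k v. k \<in> carrier K \<Longrightarrow> v \<in> S \<Longrightarrow> av k v \<in> S"
  shows "int (order K) dvd sum f S"
proof -
  obtain D where "f = pullback G K av D"
    using f by (auto simp: pullbacks0_def)
  then have "sum f S = (\<Sum>v\<in>S. int (card (stabilizer K av v)) * D (orbit K av v))"
    using S by (intro sum.cong) (auto simp: pullback_def)
  then show ?thesis
    using sum_stabilizer_weighted[OF finite_group finite_subset[OF S finite_vertices] S closed] by simp
qed

lemma pullbacks0_degree:
  assumes f: "f \<in> pullbacks0 G K av ae"
  shows "sum f (verts G) = 0"
proof -
  obtain D where D: "f = pullback G K av D" "(\<Sum>Q\<in>orbits K (verts G) av. D Q) = 0"
    using f by (auto simp: pullbacks0_def div_degree_def quotient_graph_def)
  have "sum f (verts G) = (\<Sum>v\<in>verts G. int (card (stabilizer K av v)) * D (orbit K av v))"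
    unfolding D by (intro sum.cong) (auto simp: pullback_def)
  then show ?thesis
    using sum_stabilizer_weighted[OF finite_group finite_vertices order.refl, of D] D(2) element_image
    by auto
qed

lemma zero_pullbacks0: "0 \<in> pullbacks0 G K av ae"
  unfolding pullbacks0_def
  by (auto simp: pullback_def divisors_def div_degree_def fun_eq_iff intro!: exI[of _ 0])

lemma diff_pullbacks0:
  assumes "f \<in> pullbacks0 G K av ae" "g \<in> pullbacks0 G K av ae"
  shows "f - g \<in> pullbacks0 G K av ae"
proof -
  obtain D D' where "f = pullback G K av D" "g = pullback G K av D'"
    "D \<in> divisors (quotient_graph G K av ae)" "D' \<in> divisors (quotient_graph G K av ae)"
    "div_degree (quotient_graph G K av ae) D = 0" "div_degree (quotient_graph G K av ae) D' = 0"
    using assms by (auto simp: pullbacks0_def)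
  then show ?thesis
    unfolding pullbacks0_def
    by (auto simp: pullback_def divisors_def div_degree_def fun_eq_iff sum_subtractf
        right_diff_distrib intro!: exI[of _ "D - D'"])
qed

text \<open>This is the source of every relation used for sufficiency. Summing over group elements
  instead of orbit points counts each point with its stabilizer order, so the sum of translates of
  \<open>v\<close> is the pullback of the point divisor at the orbit of \<open>v\<close>; a
  difference of two such has degree zero.\<close>

lemma orbit_sum_diff_in_pullbacks0:
  assumes v: "v \<in> verts G" and w: "w \<in> verts G"
  shows "(\<Sum>k\<in>carrier K. point_divisor (av k v)) - (\<Sum>k\<in>carrier K. point_divisor (av k w))
    \<in> pullbacks0 G K av ae"
proof -
  define D where "D Q = (if Q = orbit K av v then 1 else 0) - (if Q = orbit K av w then 1 else 0 :: int)" for Q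
  have orb: "orbit K av v \<in> orbits K (verts G) av" "orbit K av w \<in> orbits K (verts G) av"
    using v w by (auto simp: orbits_def)
  have fin: "finite (orbits K (verts G) av)"
    using finite_vertices by (simp add: orbits_def setcompr_eq_image)
  have translates: "(\<Sum>k\<in>carrier K. point_divisor (av k p)) u
      = (if u \<in> verts G \<and> orbit K av u = orbit K av p then int (card (stabilizer K av u)) else 0)"
    if p: "p \<in> verts G" for p u
  proof -
    have "(\<Sum>k\<in>carrier K. point_divisor (av k p)) u = int (card {k \<in> carrier K. av k p = u})"
      using finite_group by (auto simp: sum_fun_apply point_divisor_def sum.If_cases Int_def conj_commute eq_commute)
    moreover have "{k \<in> carrier K. av k p = u} = {}" if "u \<notin> verts G"
      using that p element_image by auto
    ultimately show ?thesis
      using card_transporter[OF p, of u] by (cases "u \<in> verts G") auto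
  qed
  have "(\<Sum>k\<in>carrier K. point_divisor (av k v)) - (\<Sum>k\<in>carrier K. point_divisor (av k w))
      = pullback G K av D"
    using translates[OF v] translates[OF w] by (auto simp: fun_eq_iff pullback_def D_def)
  moreover have "D \<in> divisors (quotient_graph G K av ae)"
    using orb by (auto simp: divisors_def quotient_graph_def D_def)
  moreover have "div_degree (quotient_graph G K av ae) D = 0"
    using orb fin by (simp add: div_degree_def quotient_graph_def D_def sum_subtractf)
  ultimately show ?thesis
    by (auto simp: pullbacks0_def)
qed

end

section \<open>Congruence modulo an additive subgroup\<close>

text \<open>\<open>M\<close> is only an additive subgroup, not an ideal: the ambient ring serves to
  write integer multiples as \<open>of_int k * a\<close>.\<close>

locale int_submodule =
  fixes M :: "'r::comm_ring_1 set"
  assumes zero_closed: "0 \<in> M"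
    and diff_closed: "a \<in> M \<Longrightarrow> b \<in> M \<Longrightarrow> a - b \<in> M"
begin

definition equiv_mod :: "'r \<Rightarrow> 'r \<Rightarrow> bool" (infix \<open>\<equiv>\<^sub>M\<close> 50) where
  "a \<equiv>\<^sub>M b \<longleftrightarrow> a - b \<in> M"

lemma add_closed:
  assumes "a \<in> M" "b \<in> M"
  shows "a + b \<in> M"
  using diff_closed[OF assms(1) diff_closed[OF zero_closed assms(2)]] by simp

lemma of_nat_mult_closed: "a \<in> M \<Longrightarrow> of_nat k * a \<in> M"
  by (induction k) (auto simp: zero_closed add_closed algebra_simps)

lemma of_int_mult_closed:
  assumes "a \<in> M"
  shows "of_int k * a \<in> M"
proof (cases k)
  case (nonneg m)
  then show ?thesis
    using of_nat_mult_closed[OF assms] by simp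
next
  case (neg m)
  then show ?thesis
    using diff_closed[OF zero_closed of_nat_mult_closed[OF assms, of "Suc m"]]
    by (simp only: of_int_minus of_int_of_nat_eq diff_0 mult_minus_left)
qed

lemma equiv_refl: "a \<equiv>\<^sub>M a"
  by (simp add: equiv_mod_def zero_closed)

lemma equiv_sym: "a \<equiv>\<^sub>M b \<Longrightarrow> b \<equiv>\<^sub>M a"
  using diff_closed[OF zero_closed, of "a - b"] by (simp add: equiv_mod_def)

lemma equiv_trans [trans]: "a \<equiv>\<^sub>M b \<Longrightarrow> b \<equiv>\<^sub>M c \<Longrightarrow> a \<equiv>\<^sub>M c"
  using add_closed[of "a - b" "b - c"] by (simp add: equiv_mod_def)

lemma equiv_add: "a \<equiv>\<^sub>M b \<Longrightarrow> c \<equiv>\<^sub>M d \<Longrightarrow> a + c \<equiv>\<^sub>M b + d"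
  using add_closed[of "a - b" "c - d"] by (simp add: equiv_mod_def algebra_simps)

lemma equiv_diff: "a \<equiv>\<^sub>M b \<Longrightarrow> c \<equiv>\<^sub>M d \<Longrightarrow> a - c \<equiv>\<^sub>M b - d"
  using diff_closed[of "a - b" "c - d"] by (simp add: equiv_mod_def algebra_simps)

lemma equiv_scale: "a \<equiv>\<^sub>M b \<Longrightarrow> of_int k * a \<equiv>\<^sub>M of_int k * b"
  using of_int_mult_closed[of "a - b" k] by (simp add: equiv_mod_def right_diff_distrib)

lemma equiv_sum: "(\<And>i. i \<in> I \<Longrightarrow> f i \<equiv>\<^sub>M g i) \<Longrightarrow> sum f I \<equiv>\<^sub>M sum g I"
  by (induction I rule: infinite_finite_induct) (auto simp: equiv_refl equiv_add)

lemma progression_equiv: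
  assumes "\<And>i. w (i + 1) \<equiv>\<^sub>M w i + R"
  shows "w (int k) \<equiv>\<^sub>M w 0 + of_int (int k) * R"
proof (induction k)
  case 0
  then show ?case
    by (simp add: equiv_refl)
next
  case (Suc k)
  have "w (int (Suc k)) \<equiv>\<^sub>M w (int k) + R"
    using assms[of "int k"] by (simp add: add.commute)
  also have "\<dots> \<equiv>\<^sub>M (w 0 + of_int (int k) * R) + R"
    by (intro equiv_add Suc equiv_refl)
  finally show ?case
    by (simp add: algebra_simps)
qed

text \<open>Substituting \<open>w 0 + of_int i * R\<close> for \<open>w i\<close> reduces a weighted
  row to two integers, its total weight and its first moment. The base index 0 makes the moment
  weights exactly \<open>i\<close>.\<close>

lemma weighted_progression_equiv:
  fixes c :: "int \<Rightarrow> int"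
  assumes step: "\<And>i. w (i + 1) \<equiv>\<^sub>M w i + R"
  shows "(\<Sum>i=1..int n. of_int (c i) * w i)
    \<equiv>\<^sub>M of_int (\<Sum>i=1..int n. c i) * w 0 + of_int (\<Sum>i=1..int n. i * c i) * R"
proof -
  have "(\<Sum>i=1..int n. of_int (c i) * w i) \<equiv>\<^sub>M (\<Sum>i=1..int n. of_int (c i) * (w 0 + of_int i * R))"
  proof (intro equiv_sum equiv_scale)
    fix i assume "i \<in> {1..int n}"
    then show "w i \<equiv>\<^sub>M w 0 + of_int i * R"
      using progression_equiv[of w R "nat i", OF step] by simp
  qed
  also have "(\<Sum>i=1..int n. of_int (c i) * (w 0 + of_int i * R))
      = of_int (\<Sum>i=1..int n. c i) * w 0 + of_int (\<Sum>i=1..int n. i * c i) * R"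
    by (simp add: distrib_left sum.distrib sum_distrib_left mult_ac)
  finally show ?thesis .
qed

end

section \<open>Dihedral labellings\<close>

lemma sum_reflect:
  fixes g :: "int \<Rightarrow> 'a::comm_monoid_add"
  shows "(\<Sum>i=a..b. g (a + b - i)) = (\<Sum>i=a..b. g i)"
  by (rule sum.reindex_bij_witness[where i = "\<lambda>i. a + b - i" and j = "\<lambda>i. a + b - i"]) auto

text \<open>The reflection by \<open>\<sigma>2\<close> maps \<open>{1..int n}\<close> onto
  \<open>{2..int n + 1}\<close>. The boundary terms must be kept because the weight \<open>i\<close>
  in the moment is not periodic.\<close>

lemma sum_shift_by_one:
  fixes g :: "int \<Rightarrow> int"
  assumes "0 < n"
  shows "(\<Sum>i=2..int n + 1. g i) = (\<Sum>i=1..int n. g i) + g (int n + 1) - g 1"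
proof -
  have "(\<Sum>i=1..int n + 1. g i) = g 1 + (\<Sum>i=2..int n + 1. g i)"
    using assms by (subst simp_from_to) auto
  moreover have "{1..int n + 1} = insert (int n + 1) {1..int n}"
    by auto
  then have "(\<Sum>i=1..int n + 1. g i) = (\<Sum>i=1..int n. g i) + g (int n + 1)"
    by simp
  ultimately show ?thesis
    by simp
qed

lemma periodic_multiple:
  fixes w :: "int \<Rightarrow> 'a"
  assumes "\<And>i. w (i + int n) = w i"
  shows "w (i + int n * k) = w i"
proof (induction k rule: int_induct[where k = 0])
  case base
  show ?case by simp
next
  case (step1 k)
  then show ?case
    using assms[of "i + int n * k"] by (simp add: algebra_simps)
next
  case (step2 k)
  then show ?case
    using assms[of "i + int n * (k - 1)"] by (simp add: algebra_simps)
qed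

lemma periodic_range:
  fixes w :: "int \<Rightarrow> 'a"
  assumes "0 < n" "\<And>i. w (i + int n) = w i"
  shows "range w = w ` {1..int n}"
proof -
  have "w i \<in> w ` {1..int n}" for i
  proof
    \<comment> \<open>Subtracting 1 before reducing and adding it back places the residue in
      \<open>{1..int n}\<close>.\<close>
    show "w i = w (1 + (i - 1) mod int n)"
      using periodic_multiple[of w n "1 + (i - 1) mod int n" "(i - 1) div int n", OF assms(2)]
      by (simp add: algebra_simps)
    show "1 + (i - 1) mod int n \<in> {1..int n}"
      using pos_mod_bound[of "int n" "i - 1"] pos_mod_sign[of "int n" "i - 1"] assms(1) unfolding atLeastAtMost_iff by linarith
  qed
  then show ?thesis
    by auto
qed

lemma (in group) generate_involution:
  assumes "g \<in> carrier G" "g \<otimes> g = \<one>"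
  shows "generate G {g} = {\<one>, g}"
proof
  show "{\<one>, g} \<subseteq> generate G {g}"
    by (auto intro: generate.intros)
  have "subgroup {\<one>, g} G"
    using assms inv_equality[of g g] by unfold_locales auto
  then show "generate G {g} \<subseteq> {\<one>, g}"
    by (intro generate_subgroup_incl) auto
qed

section \<open>Rows of labels exchanged by the involutions\<close>

context labelled_dihedral_action
begin

abbreviation "cyclic g \<equiv> subgroup_generated_by A g"

lemma finite_carrier: "finite (carrier A)"
  using order_dihedral n_pos by (simp add: order_def card_ge_0_finite)

lemma cyclic_action:
  assumes "g \<in> carrier A"
  shows "finite_vertex_action G (cyclic g) av"
proof -
  have sub: "subgroup (generate A {g}) A"
    using assms by (intro generate_is_subgroup) auto
  show ?thesis
    unfolding finite_vertex_action_def finite_vertex_action_axioms_def subgroup_generated_by_def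
    using on_verts.induced_action[OF sub] finite_verts finite_subset[OF subgroup.subset[OF sub] finite_carrier]
    by auto
qed

lemma carrier_cyclic: "carrier (cyclic g) = generate A {g}"
  by (simp add: subgroup_generated_by_def)

lemma action_one: "v \<in> verts G \<Longrightarrow> av \<one>\<^bsub>A\<^esub> v = v"
  using on_verts.id_eq_one by (metis restrict_apply')

lemma carrier_sigma1: "carrier (cyclic \<sigma>1) = {\<one>\<^bsub>A\<^esub>, \<sigma>1}"
  and carrier_sigma2: "carrier (cyclic \<sigma>2) = {\<one>\<^bsub>A\<^esub>, \<sigma>2}"
  using generate_involution sigma_carrier sigma_involution by (auto simp: carrier_cyclic)

text \<open>The two involutions exchange \<open>w\<close> and \<open>w'\<close> and reverse their indices; the instances are
  \<open>(z\<^sup>j, z\<^sup>j)\<close>, \<open>(x\<^sup>j, y\<^sup>j)\<close> and \<open>(y\<^sup>j, x\<^sup>j)\<close>.\<close>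

definition mates :: "(int \<Rightarrow> 'v) \<Rightarrow> (int \<Rightarrow> 'v) \<Rightarrow> bool" where
  "mates w w' \<longleftrightarrow>
    range w \<subseteq> verts G \<and> range w' \<subseteq> verts G
    \<and> (\<forall>i. w (i + int n) = w i) \<and> (\<forall>i. w' (i + int n) = w' i)
    \<and> (\<forall>i. av \<sigma>1 (w i) = w' (int n + 1 - i)) \<and> (\<forall>i. av \<sigma>1 (w' i) = w (int n + 1 - i))
    \<and> (\<forall>i. av \<sigma>2 (w i) = w' (int n + 2 - i)) \<and> (\<forall>i. av \<sigma>2 (w' i) = w (int n + 2 - i))"

lemma matesD:
  assumes "mates w w'"
  shows "w i \<in> verts G" "w' i \<in> verts G" "w (i + int n) = w i" "w' (i + int n) = w' i"
    "av \<sigma>1 (w i) = w' (int n + 1 - i)" "av \<sigma>1 (w' i) = w (int n + 1 - i)"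
    "av \<sigma>2 (w i) = w' (int n + 2 - i)" "av \<sigma>2 (w' i) = w (int n + 2 - i)"
  using assms by (auto simp: mates_def)

lemma mates_sym: "mates w w' \<Longrightarrow> mates w' w"
  by (auto simp: mates_def)

lemma labels_in_verts:
  shows "j \<in> {1..s} \<Longrightarrow> range (\<lambda>i. z i j) \<subseteq> verts G"
    and "j \<in> {1..t} \<Longrightarrow> range (\<lambda>i. x i j) \<subseteq> verts G"
    and "j \<in> {1..t} \<Longrightarrow> range (\<lambda>i. y i j) \<subseteq> verts G"
proof -
  show "range (\<lambda>i. z i j) \<subseteq> verts G" if j: "j \<in> {1..s}"
  proof -
    have "range (\<lambda>i. z i j) = (\<lambda>i. z i j) ` {1..int n}"
      using periodic(1)[OF j] by (intro periodic_range n_pos)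
    then show ?thesis
      using j unfolding labels_verts by blast
  qed
  show "range (\<lambda>i. x i j) \<subseteq> verts G" if j: "j \<in> {1..t}"
  proof -
    have "range (\<lambda>i. x i j) = (\<lambda>i. x i j) ` {1..int n}"
      using periodic(2)[OF j] by (intro periodic_range n_pos)
    then show ?thesis
      using j unfolding labels_verts by blast
  qed
  show "range (\<lambda>i. y i j) \<subseteq> verts G" if j: "j \<in> {1..t}"
  proof -
    have "range (\<lambda>i. y i j) = (\<lambda>i. y i j) ` {1..int n}"
      using periodic(3)[OF j] by (intro periodic_range n_pos)
    then show ?thesis
      using j unfolding labels_verts by blast
  qed
qed

lemma mates_z: "j \<in> {1..s} \<Longrightarrow> mates (\<lambda>i. z i j) (\<lambda>i. z i j)"
  by (simp add: mates_def labels_in_verts periodic sigma1_labels sigma2_labels)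

lemma mates_xy: "j \<in> {1..t} \<Longrightarrow> mates (\<lambda>i. x i j) (\<lambda>i. y i j)"
  by (simp add: mates_def labels_in_verts periodic sigma1_labels sigma2_labels)

lemma vertex_cases:
  assumes "v \<in> verts G"
  obtains w w' i where "mates w w'" "v = w i"
  using assms mates_z mates_xy mates_sym[OF mates_xy] unfolding labels_verts by blast

lemma sum_verts:
  fixes f :: "'v \<Rightarrow> 'c::comm_monoid_add"
  shows "sum f (verts G) = (\<Sum>j=1..s. \<Sum>i=1..int n. f (z i j))
    + (\<Sum>j=1..t. (\<Sum>i=1..int n. f (x i j)) + (\<Sum>i=1..int n. f (y i j)))"
proof -
  let ?Z = "(\<lambda>(i, j). z i j) ` ({1..int n} \<times> {1..s})"
  let ?X = "(\<lambda>(i, j). x i j) ` ({1..int n} \<times> {1..t})"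
  let ?Y = "(\<lambda>(i, j). y i j) ` ({1..int n} \<times> {1..t})"
  have "{w i j |i j. i \<in> I \<and> j \<in> J} = (\<lambda>(i, j). w i j) ` (I \<times> J)"
    for w :: "int \<Rightarrow> nat \<Rightarrow> 'v" and I J
    by fastforce
  then have V: "verts G = ?Z \<union> (?X \<union> ?Y)"
    unfolding labels_verts by (simp only: Un_assoc)
  have disj: "?Z \<inter> (?X \<union> ?Y) = {}" "?X \<inter> ?Y = {}"
    using labels_disjoint by (fastforce simp: image_def)+
  have family: "sum f ((\<lambda>(i, j). w i j) ` ({1..int n} \<times> {1..r})) = (\<Sum>j=1..r. \<Sum>i=1..int n. f (w i j))"
    if "inj_on (\<lambda>(i, j). w i j) ({1..int n} \<times> {1..r})" for w :: "int \<Rightarrow> nat \<Rightarrow> 'v" and r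
    using that by (subst sum.swap) (simp add: sum.reindex sum.cartesian_product case_prod_unfold)
  have "sum f (verts G) = sum f ?Z + (sum f ?X + sum f ?Y)"
    unfolding V using disj by (simp add: sum.union_disjoint)
  then show ?thesis
    using labels_inj by (simp only: family sum.distrib)
qed

section \<open>The rotation and its cyclic group\<close>

abbreviation rotation :: 'g where
  "rotation \<equiv> \<sigma>1 \<otimes>\<^bsub>A\<^esub> \<sigma>2"

lemma rotation_carrier: "rotation \<in> carrier A"
  using sigma_carrier by simp

text \<open>\<open>\<sigma>2\<close> acts first: the index \<open>i\<close> becomes
  \<open>n + 2 - i\<close>, and then \<open>n + 1 - (n + 2 - i) = i - 1\<close>. The two exchanges
  of the mates cancel.\<close>

lemma action_rotation:
  assumes "mates w w'"
  shows "av rotation (w i) = w (i - 1)"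
  using matesD[OF assms] sigma_carrier by (simp add: on_verts.composition_rule)

lemma action_rotation_pow:
  assumes "mates w w'"
  shows "av (rotation [^]\<^bsub>A\<^esub> k) (w i) = w (i - int k)"
proof (induction k arbitrary: i)
  case 0
  then show ?case
    using matesD[OF assms] action_one by simp
next
  case (Suc k)
  then show ?case
    using matesD(1)[OF assms] rotation_carrier action_rotation[OF assms]
    by (simp add: on_verts.composition_rule algebra_simps)
qed

text \<open>By periodicity this power fixes every vertex. Two distinct \<open>z\<close> vertices and
  connectedness supply an edge, and harmonicity forbids a nontrivial element from fixing both of its
  ends.\<close>

lemma rotation_pow_n:
  assumes n: "2 \<le> n" and s: "1 \<le> s"
  shows "rotation [^]\<^bsub>A\<^esub> n = \<one>\<^bsub>A\<^esub>"
proof (rule ccontr)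
  assume nontriv: "rotation [^]\<^bsub>A\<^esub> n \<noteq> \<one>\<^bsub>A\<^esub>"
  have "z 1 1 \<noteq> z 2 1"
    using inj_onD[OF labels_inj(1), of "(1, 1)" "(2, 1)"] n s by auto
  moreover have "(z 1 1, z 2 1) \<in> (adjacency G)\<^sup>*"
    using connected matesD(1)[OF mates_z] s by simp
  ultimately obtain e where e: "e \<in> edges G"
    by (auto elim: converse_rtranclE simp: adjacency_def)
  have "av (rotation [^]\<^bsub>A\<^esub> n) v = v" if "v \<in> verts G" for v
    using that
  proof (cases rule: vertex_cases)
    case (1 w w' i)
    then show ?thesis
      using action_rotation_pow[of w w' n i] matesD(3)[of w w' "i - int n"] by simp
  qed
  then show False
    using harmonic[OF _ nontriv e] ends_in_verts[OF e] rotation_carrier by blast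
qed

text \<open>The exponent \<open>n - k\<close> is chosen so that the \<open>k\<close>-th element
  moves index \<open>n\<close> to index \<open>k\<close>. Injectivity is then visible at
  \<open>z (int n) 1\<close>, and a sum over the group becomes a sum along a row.\<close>

lemma carrier_rotation:
  assumes n: "2 \<le> n" and s: "1 \<le> s"
  shows "bij_betw (\<lambda>k. rotation [^]\<^bsub>A\<^esub> nat (int n - k)) {1..int n} (carrier (cyclic rotation))"
proof (rule bij_betw_imageI)
  let ?r = "\<lambda>k. rotation [^]\<^bsub>A\<^esub> nat (int n - k)"
  show "inj_on ?r {1..int n}"
  proof (rule inj_onI)
    fix k l assume kl: "k \<in> {1..int n}" "l \<in> {1..int n}" "?r k = ?r l"
    have "av (?r i) (z (int n) 1) = z i 1" if "i \<in> {1..int n}" for i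
      using action_rotation_pow[OF mates_z, of 1 "nat (int n - i)" "int n"] s that by simp
    then have "z k 1 = z l 1"
      using kl by metis
    then show "k = l"
      using inj_onD[OF labels_inj(1), of "(k, 1)" "(l, 1)"] kl s by auto
  qed
  show "?r ` {1..int n} = carrier (cyclic rotation)"
    unfolding carrier_cyclic generate_pow_on_finite_carrier[OF finite_carrier rotation_carrier]
  proof (intro equalityI subsetI)
    fix g assume "g \<in> ?r ` {1..int n}"
    then show "g \<in> {rotation [^]\<^bsub>A\<^esub> k |k. k \<in> (UNIV :: nat set)}"
      by blast
  next
    fix g assume "g \<in> {rotation [^]\<^bsub>A\<^esub> k |k. k \<in> (UNIV :: nat set)}"
    then obtain k :: nat where k: "g = rotation [^]\<^bsub>A\<^esub> k"
      by auto
    have "rotation [^]\<^bsub>A\<^esub> k = rotation [^]\<^bsub>A\<^esub> (n * (k div n) + k mod n)"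
      by simp
    also have "\<dots> = (rotation [^]\<^bsub>A\<^esub> n) [^]\<^bsub>A\<^esub> (k div n) \<otimes>\<^bsub>A\<^esub> rotation [^]\<^bsub>A\<^esub> (k mod n)"
      using rotation_carrier by (simp only: nat_pow_mult nat_pow_pow)
    also have "\<dots> = rotation [^]\<^bsub>A\<^esub> (k mod n)"
      using rotation_pow_n[OF assms] rotation_carrier by simp
    also have "\<dots> = ?r (int n - int (k mod n))"
      by simp
    finally have "g = ?r (int n - int (k mod n))"
      unfolding k .
    moreover have "int n - int (k mod n) \<in> {1..int n}"
      using mod_less_divisor[OF n_pos, of k] unfolding atLeastAtMost_iff by linarith
    ultimately show "g \<in> ?r ` {1..int n}"
      by blast
  qed
qed

text \<open>The whole range is visibly stable under index reflections, as
  \<open>pullbacks0_sum_dvd\<close> requires, while the criterion sums over representatives.\<close>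

lemma sum_z_range:
  fixes f :: "'v \<Rightarrow> int"
  assumes j: "j \<in> {1..s}"
  shows "sum f (range (\<lambda>i. z i j)) = (\<Sum>i=1..int n. f (z i j))"
proof -
  have "range (\<lambda>i. z i j) = (\<lambda>i. z i j) ` {1..int n}"
    using matesD(3)[OF mates_z[OF j]] by (intro periodic_range n_pos)
  moreover have "inj_on (\<lambda>i. z i j) {1..int n}"
  proof (rule inj_onI)
    fix k l assume "k \<in> {1..int n}" "l \<in> {1..int n}" "z k j = z l j"
    then show "k = l"
      using inj_onD[OF labels_inj(1), of "(k, j)" "(l, j)"] j by simp
  qed
  ultimately show ?thesis
    by (simp add: sum.reindex)
qed

section \<open>The numerical criterion\<close>

definition column_sum :: "('v \<Rightarrow> int) \<Rightarrow> int \<Rightarrow> int" where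
  "column_sum f i = (\<Sum>j=1..t. f (x i j)) + (\<Sum>j=1..t. f (y i j)) + (\<Sum>j=1..s. f (z i j))"

definition criterion :: "('v \<Rightarrow> int) \<Rightarrow> bool" where
  "criterion f \<longleftrightarrow>
    [(\<Sum>i=1..int n. i * column_sum f i) = 0] (mod int n)
    \<and> (\<forall>j\<in>{1..t}. [(\<Sum>i=1..int n. f (x i j)) = (\<Sum>i=1..int n. f (y i j))] (mod int n))
    \<and> (\<forall>j\<in>{1..s}. [(\<Sum>i=1..int n. f (z i j)) = 0] (mod 2))"

lemma sum_verts_columns: "sum f (verts G) = (\<Sum>i=1..int n. column_sum f i)"
  unfolding column_sum_def sum_verts sum.distrib by (simp add: sum.swap[of _ "{1..int n}"])

lemma sum_moments:
  "(\<Sum>i=1..int n. i * column_sum f i) = (\<Sum>j=1..s. \<Sum>i=1..int n. i * f (z i j))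
    + (\<Sum>j=1..t. (\<Sum>i=1..int n. i * f (x i j)) + (\<Sum>i=1..int n. i * f (y i j)))"
  unfolding column_sum_def distrib_left sum_distrib_left sum.distrib
  by (simp add: sum.swap[of _ "{1..int n}"])

lemma criterion_add:
  assumes "criterion f" "criterion g"
  shows "criterion (\<lambda>v. f v + g v)"
proof -
  have "column_sum (\<lambda>v. f v + g v) i = column_sum f i + column_sum g i" for i
    by (simp add: column_sum_def sum.distrib)
  then show ?thesis
    using assms by (auto simp: criterion_def sum.distrib distrib_left cong_0_iff intro!: cong_add)
qed

end

section \<open>The sum of pullback groups as an additive subgroup\<close>

lemma (in finite_vertex_action) int_submodule_pullbacks0: "int_submodule (pullbacks0 G K av ae)"
  by unfold_locales (use zero_pullbacks0 diff_pullbacks0 in auto)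

lemma int_submodule_sum3:
  assumes "int_submodule P1" "int_submodule P2" "int_submodule P3"
  shows "int_submodule (sum3 P1 P2 P3)"
proof
  show "0 \<in> sum3 P1 P2 P3"
    using assms[THEN int_submodule.zero_closed] unfolding sum3_def
    by (auto simp: fun_eq_iff intro!: exI[of _ 0])
next
  fix f g assume "f \<in> sum3 P1 P2 P3" "g \<in> sum3 P1 P2 P3"
  then obtain f1 f2 f3 g1 g2 g3 where
    "f = (\<lambda>v. f1 v + f2 v + f3 v)" "f1 \<in> P1" "f2 \<in> P2" "f3 \<in> P3"
    "g = (\<lambda>v. g1 v + g2 v + g3 v)" "g1 \<in> P1" "g2 \<in> P2" "g3 \<in> P3"
    unfolding sum3_def by blast
  then show "f - g \<in> sum3 P1 P2 P3"
    using assms[THEN int_submodule.diff_closed] unfolding sum3_def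
    by (intro CollectI exI[of _ "f1 - g1"] exI[of _ "f2 - g2"] exI[of _ "f3 - g3"])
      (auto simp: fun_eq_iff)
qed

lemma sum3_incl:
  assumes "0 \<in> P1" "0 \<in> P2" "0 \<in> P3"
  shows "P1 \<subseteq> sum3 P1 P2 P3" "P2 \<subseteq> sum3 P1 P2 P3" "P3 \<subseteq> sum3 P1 P2 P3"
proof -
  have "f1 + f2 + f3 \<in> sum3 P1 P2 P3" if "f1 \<in> P1" "f2 \<in> P2" "f3 \<in> P3" for f1 f2 f3
    using that unfolding sum3_def by (auto simp: fun_eq_iff)
  then show "P1 \<subseteq> sum3 P1 P2 P3" "P2 \<subseteq> sum3 P1 P2 P3" "P3 \<subseteq> sum3 P1 P2 P3"
    using assms by (metis add.right_neutral add.left_neutral subsetI)+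
qed

section \<open>Necessity, for each of the three kinds of pullback\<close>

context labelled_dihedral_action
begin

text \<open>Invariance makes the columns symmetric under \<open>i\<close> to
  \<open>n + 1 - i\<close>. So the moment equals \<open>n + 1\<close> times the degree minus itself,
  and it vanishes. The same reflection matches \<open>x\<close> rows with \<open>y\<close> rows, and
  a \<open>z\<close> row is stable under a group of order 2.\<close>

lemma criterion_pullbacks0_sigma1:
  assumes f: "f \<in> pullbacks0 G (cyclic \<sigma>1) av ae"
  shows "criterion f"
proof -
  interpret K: finite_vertex_action G "cyclic \<sigma>1" av
    by (rule cyclic_action) (rule sigma_carrier)
  have order: "order (cyclic \<sigma>1) = 2"
    using sigma_nontrivial by (simp add: order_def carrier_sigma1)
  have inv: "f (av \<sigma>1 v) = f v" if "v \<in> verts G" for v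
    using K.pullbacks0_invariant[OF f that] by (simp add: carrier_sigma1)
  have mate: "f (w (int n + 1 - i)) = f (w' i)" if "mates w w'" for w w' i
    using inv[OF matesD(2)[OF that]] matesD(6)[OF that] by metis
  note zz = mate[OF mates_z] and xy = mate[OF mates_xy] and yx = mate[OF mates_sym[OF mates_xy]]
  have column: "column_sum f (int n + 1 - i) = column_sum f i" for i
    by (simp add: column_sum_def zz xy yx)
  have deg: "(\<Sum>i=1..int n. column_sum f i) = 0"
    using K.pullbacks0_degree[OF f] sum_verts_columns by simp
  have "(\<Sum>i=1..int n. i * column_sum f i)
      = (\<Sum>i=1..int n. (int n + 1 - i) * column_sum f i)"
    using sum_reflect[of "\<lambda>i. i * column_sum f i" 1 "int n"] column by (simp add: add.commute)
  also have "\<dots> = (int n + 1) * (\<Sum>i=1..int n. column_sum f i) - (\<Sum>i=1..int n. i * column_sum f i)"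
    by (simp add: left_diff_distrib sum_subtractf sum_distrib_left)
  finally have moment: "(\<Sum>i=1..int n. i * column_sum f i) = 0"
    using deg by simp
  have xy_sum: "(\<Sum>i=1..int n. f (x i j)) = (\<Sum>i=1..int n. f (y i j))" if "j \<in> {1..t}" for j
    using sum_reflect[of "\<lambda>i. f (x i j)" 1 "int n"] xy[OF that] by (simp add: add.commute)
  have "2 dvd (\<Sum>i=1..int n. f (z i j))" if j: "j \<in> {1..s}" for j
  proof -
    have "int (order (cyclic \<sigma>1)) dvd sum f (range (\<lambda>i. z i j))"
      using matesD[OF mates_z[OF j]] action_one
      by (intro K.pullbacks0_sum_dvd[OF f]) (auto simp: carrier_sigma1)
    then show ?thesis
      unfolding order sum_z_range[OF j] by simp
  qed
  then show ?thesis
    using moment xy_sum by (simp add: criterion_def cong_0_iff)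
qed

lemma criterion_pullbacks0_sigma2:
  assumes f: "f \<in> pullbacks0 G (cyclic \<sigma>2) av ae"
  shows "criterion f"
proof -
  interpret K: finite_vertex_action G "cyclic \<sigma>2" av
    by (rule cyclic_action) (rule sigma_carrier)
  have order: "order (cyclic \<sigma>2) = 2"
    using sigma_nontrivial by (simp add: order_def carrier_sigma2)
  have inv: "f (av \<sigma>2 v) = f v" if "v \<in> verts G" for v
    using K.pullbacks0_invariant[OF f that] by (simp add: carrier_sigma2)
  have mate: "f (w (int n + 2 - i)) = f (w' i)" if "mates w w'" for w w' i
    using inv[OF matesD(2)[OF that]] matesD(8)[OF that] by metis
  note zz = mate[OF mates_z] and xy = mate[OF mates_xy] and yx = mate[OF mates_sym[OF mates_xy]]
  have column: "column_sum f (int n + 2 - i) = column_sum f i" for i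
    by (simp add: column_sum_def zz xy yx)
  have period: "column_sum f (int n + 1) = column_sum f 1"
    using column[of 1] by (simp add: add.commute)
  have deg: "(\<Sum>i=1..int n. column_sum f i) = 0"
    using K.pullbacks0_degree[OF f] sum_verts_columns by simp
  let ?W = "\<Sum>i=1..int n. i * column_sum f i"
  have reflect: "(\<Sum>i=2..int n + 1. g (int n + 2 - i)) = (\<Sum>i=1..int n. g i)" for g :: "int \<Rightarrow> int"
    by (rule sum.reindex_bij_witness[where i = "\<lambda>i. int n + 2 - i" and j = "\<lambda>i. int n + 2 - i"]) auto
  have "?W = (\<Sum>i=2..int n + 1. (int n + 2 - i) * column_sum f i)"
    using reflect[of "\<lambda>i. i * column_sum f i"] column by simp
  also have "\<dots> = (int n + 2) * (\<Sum>i=2..int n + 1. column_sum f i) - (\<Sum>i=2..int n + 1. i * column_sum f i)"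
    by (simp add: left_diff_distrib sum_subtractf sum_distrib_left)
  \<comment> \<open>Shifting back to \<open>{1..int n}\<close> costs \<open>(n + 1) - 1 = n\<close>
    copies of the first column, since columns 1 and \<open>n + 1\<close> agree.\<close>
  also have "\<dots> = - ?W - int n * column_sum f 1"
    unfolding sum_shift_by_one[OF n_pos] using deg period by (simp add: algebra_simps)
  finally have W: "2 * ?W = - (int n * column_sum f 1)"
    by simp
  \<comment> \<open>Halving the last identity needs an even first column. \<open>\<sigma>2\<close>
    fixes \<open>z 1 j\<close>, so \<open>f\<close> is even there, and it exchanges
    \<open>x 1 j\<close> with \<open>y 1 j\<close>, where \<open>f\<close> takes equal
    values.\<close>
  have "even (column_sum f 1)"
  proof -
    have "even (\<Sum>j=1..s. f (z 1 j))"
    proof (rule dvd_sum)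
      fix j assume j: "j \<in> {1..s}"
      have "int (order (cyclic \<sigma>2)) dvd sum f {z 1 j}"
        using matesD[OF mates_z[OF j]] matesD(3)[OF mates_z[OF j], of 1] action_one
        by (intro K.pullbacks0_sum_dvd[OF f]) (auto simp: carrier_sigma2 add.commute)
      then show "even (f (z 1 j))"
        unfolding order by simp
    qed
    moreover have "f (x 1 j) = f (y 1 j)" if "j \<in> {1..t}" for j
      using xy[OF that, of 1] matesD(3)[OF mates_xy[OF that], of 1] by (simp add: add.commute)
    ultimately show ?thesis
      unfolding column_sum_def by simp
  qed
  then obtain m where "column_sum f 1 = 2 * m"
    by blast
  then have "?W = int n * (- m)"
    using W by simp
  then have moment: "int n dvd ?W"
    by (rule dvdI)
  have xy_sum: "(\<Sum>i=1..int n. f (x i j)) = (\<Sum>i=1..int n. f (y i j))" if j: "j \<in> {1..t}" for j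
  proof -
    have "(\<Sum>i=1..int n. f (x i j)) = (\<Sum>i=2..int n + 1. f (y i j))"
      using reflect[of "\<lambda>i. f (x i j)"] xy[OF j] by simp
    also have "\<dots> = (\<Sum>i=1..int n. f (y i j))"
      unfolding sum_shift_by_one[OF n_pos]
      using matesD(4)[OF mates_xy[OF j], of 1] by (simp add: add.commute)
    finally show ?thesis .
  qed
  have "2 dvd (\<Sum>i=1..int n. f (z i j))" if j: "j \<in> {1..s}" for j
  proof -
    have "int (order (cyclic \<sigma>2)) dvd sum f (range (\<lambda>i. z i j))"
      using matesD[OF mates_z[OF j]] action_one
      by (intro K.pullbacks0_sum_dvd[OF f]) (auto simp: carrier_sigma2)
    then show ?thesis
      unfolding order sum_z_range[OF j] by simp
  qed
  then show ?thesis
    using moment xy_sum by (simp add: criterion_def cong_0_iff)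
qed

text \<open>Invariance makes \<open>f\<close> constant along rows, so all columns are equal and
  degree zero makes them vanish. Row sums are multiples of \<open>n\<close>; evenness of
  \<open>n\<close> gives the parity condition on the \<open>z\<close> rows.\<close>

lemma criterion_pullbacks0_rotation:
  assumes f: "f \<in> pullbacks0 G (cyclic rotation) av ae" and "even n"
  shows "criterion f"
proof -
  interpret K: finite_vertex_action G "cyclic rotation" av
    by (rule cyclic_action) (rule rotation_carrier)
  have const: "f (w i) = f (w 0)" if w: "mates w w'" and i: "i \<in> {1..int n}" for w w' i
  proof -
    have "rotation [^]\<^bsub>A\<^esub> nat i \<in> carrier (cyclic rotation)"
      unfolding carrier_cyclic generate_pow_on_finite_carrier[OF finite_carrier rotation_carrier] by blast
    then show ?thesis
      using K.pullbacks0_invariant[OF f matesD(1)[OF w, of i]] action_rotation_pow[OF w, of "nat i" i] i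
      by fastforce
  qed
  note cz = const[OF mates_z] and cx = const[OF mates_xy] and cy = const[OF mates_sym[OF mates_xy]]
  have column: "column_sum f i = column_sum f 0" if "i \<in> {1..int n}" for i
    using that by (simp add: column_sum_def cz cx cy)
  have "(\<Sum>i=1..int n. column_sum f i) = 0"
    using K.pullbacks0_degree[OF f] sum_verts_columns by simp
  then have "column_sum f 0 = 0"
    using column n_pos by simp
  then have "(\<Sum>i=1..int n. i * column_sum f i) = 0"
    using column by simp
  moreover have "(\<Sum>i=1..int n. f (x i j)) = int n * f (x 0 j)"
    "(\<Sum>i=1..int n. f (y i j)) = int n * f (y 0 j)" if "j \<in> {1..t}" for j
    using cx[OF that] cy[OF that] by simp_all
  moreover have "(\<Sum>i=1..int n. f (z i j)) = int n * f (z 0 j)" if "j \<in> {1..s}" for j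
    using cz[OF that] by simp
  ultimately show ?thesis
    using \<open>even n\<close> by (simp add: criterion_def cong_0_iff cong_iff_dvd_diff)
qed

end

section \<open>Sufficiency, by computing modulo the sum of pullbacks\<close>

context labelled_dihedral_action
begin

lemma criterion_imp_sum_of_pullbacks:
  assumes even: "even n" and s: "1 \<le> s"
    and \<delta>: "\<delta> \<in> divisors G" and deg: "div_degree G \<delta> = 0" and crit: "criterion \<delta>"
  shows "\<delta> \<in> sum3 (pullbacks0 G (cyclic \<sigma>1) av ae) (pullbacks0 G (cyclic \<sigma>2) av ae)
    (pullbacks0 G (cyclic rotation) av ae)"
proof -
  let ?P1 = "pullbacks0 G (cyclic \<sigma>1) av ae" and ?P2 = "pullbacks0 G (cyclic \<sigma>2) av ae"
    and ?P3 = "pullbacks0 G (cyclic rotation) av ae"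
  let ?P = "sum3 ?P1 ?P2 ?P3"
  let ?e = "point_divisor :: 'v \<Rightarrow> 'v \<Rightarrow> int"
  interpret K1: finite_vertex_action G "cyclic \<sigma>1" av
    by (rule cyclic_action) (rule sigma_carrier)
  interpret K2: finite_vertex_action G "cyclic \<sigma>2" av
    by (rule cyclic_action) (rule sigma_carrier)
  interpret K3: finite_vertex_action G "cyclic rotation" av
    by (rule cyclic_action) (rule rotation_carrier)
  interpret P: int_submodule ?P
    by (intro int_submodule_sum3 K1.int_submodule_pullbacks0 K2.int_submodule_pullbacks0
        K3.int_submodule_pullbacks0)
  note incl = sum3_incl[OF K1.zero_pullbacks0 K2.zero_pullbacks0 K3.zero_pullbacks0, of ae ae ae]
  obtain h where h: "n = 2 * h"
    using even by blast
  have n2: "2 \<le> n"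
    using h n_pos by simp
  have z1: "mates (\<lambda>i. z i 1) (\<lambda>i. z i 1)"
    using mates_z s by simp
  \<comment> \<open>The group here is \<open>{\<one>, \<sigma>1}\<close>, so a sum of translates is
    \<open>v + \<sigma>1 v\<close>; a fixed vertex counts twice.\<close>
  have pair1: "P.equiv_mod (?e v + ?e (av \<sigma>1 v)) (?e u + ?e (av \<sigma>1 u))"
    if "v \<in> verts G" "u \<in> verts G" for u v
    using K1.orbit_sum_diff_in_pullbacks0[OF that] incl(1) sigma_nontrivial(1) action_one that
    by (auto simp: P.equiv_mod_def carrier_sigma1)
  have pair2: "P.equiv_mod (?e v + ?e (av \<sigma>2 v)) (?e u + ?e (av \<sigma>2 u))"
    if "v \<in> verts G" "u \<in> verts G" for u v
    using K2.orbit_sum_diff_in_pullbacks0[OF that] incl(2) sigma_nontrivial(2) action_one that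
    by (auto simp: P.equiv_mod_def carrier_sigma2)
  have rot: "P.equiv_mod (\<Sum>i=1..int n. ?e (w i)) (\<Sum>i=1..int n. ?e (z i 1))"
    if w: "mates w w'" for w w'
  proof -
    have orbit: "(\<Sum>k\<in>carrier (cyclic rotation). ?e (av k (u (int n)))) = (\<Sum>i=1..int n. ?e (u i))"
      if u: "mates u u'" for u u'
    proof -
      have "(\<Sum>k\<in>carrier (cyclic rotation). ?e (av k (u (int n))))
          = (\<Sum>i=1..int n. ?e (av (rotation [^]\<^bsub>A\<^esub> nat (int n - i)) (u (int n))))"
        using sum.reindex_bij_betw[OF carrier_rotation[OF n2 s], symmetric] .
      also have "\<dots> = (\<Sum>i=1..int n. ?e (u i))"
        unfolding action_rotation_pow[OF u] by (intro sum.cong) auto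
      finally show ?thesis .
    qed
    show ?thesis
      unfolding P.equiv_mod_def orbit[OF w, symmetric] orbit[OF z1, symmetric]
      using K3.orbit_sum_diff_in_pullbacks0[OF matesD(1)[OF w] matesD(1)[OF z1]] incl(3) by blast
  qed
  \<comment> \<open>Since \<open>\<sigma>1\<close> sends \<open>z 0 1\<close> to
    \<open>z 1 1\<close> and \<open>\<sigma>2\<close> fixes \<open>z 1 1\<close>, the common pair
    sums are represented by \<open>a = z 0 1 + z 1 1\<close> and \<open>b = 2 (z 1 1)\<close>. Thus
    \<open>R\<close> is exactly \<open>b - a\<close>, and \<open>T\<close> is exactly
    \<open>a - R\<close>.\<close>
  define R where "R = ?e (z 1 1) - ?e (z 0 1)"
  define T where "T = 2 * ?e (z 0 1)"
  have step: "P.equiv_mod (?e (w (i + 1))) (?e (w i) + R)" if w: "mates w w'" for w w' i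
  proof -
    \<comment> \<open>One vertex of the mate row is paired with both neighbours, \<open>w i\<close>
      by \<open>\<sigma>1\<close> and \<open>w (i + 1)\<close> by \<open>\<sigma>2\<close>.
      Subtracting its two pair sums leaves the step along \<open>w\<close>.\<close>
    have "av \<sigma>1 (w' (1 - i)) = w i" "av \<sigma>2 (w' (1 - i)) = w (i + 1)"
      using matesD(6,8)[OF w, of "1 - i"] matesD(3)[OF w, of i] matesD(3)[OF w, of "i + 1"]
      by (simp_all add: algebra_simps)
    moreover have "av \<sigma>1 (z 0 1) = z 1 1" "av \<sigma>2 (z 1 1) = z 1 1"
      using matesD(5)[OF z1, of 0] matesD(7)[OF z1, of 1] matesD(3)[OF z1, of 1]
      by (simp_all add: algebra_simps)
    ultimately have "P.equiv_mod (?e (w' (1 - i)) + ?e (w (i + 1)) - (?e (w' (1 - i)) + ?e (w i)))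
        (?e (z 1 1) + ?e (z 1 1) - (?e (z 0 1) + ?e (z 1 1)))"
      using pair1[of "w' (1 - i)" "z 0 1"] pair2[of "w' (1 - i)" "z 1 1"] matesD(2)[OF w] matesD(1)[OF z1]
      by (intro P.equiv_diff) auto
    then show ?thesis
      by (simp add: P.equiv_mod_def R_def algebra_simps)
  qed
  have nR: "P.equiv_mod (of_int (int n) * R) 0"
  proof -
    have "P.equiv_mod (?e (z 0 1)) (?e (z 0 1) + of_int (int n) * R)"
      using P.progression_equiv[of "\<lambda>i. ?e (z i 1)" R n, OF step[OF z1]] matesD(3)[OF z1, of 0]
      by simp
    from P.equiv_sym[OF this] show ?thesis
      by (simp add: P.equiv_mod_def)
  qed
  have sum_mates: "P.equiv_mod (?e (w 0) + ?e (w' 0)) T" if w: "mates w w'" for w w'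
  proof -
    \<comment> \<open>The pair sum of \<open>w 0\<close> is \<open>w 0 + w' 1\<close>; moving
      \<open>w' 1\<close> back to index 0 subtracts one \<open>R\<close>.\<close>
    have "av \<sigma>1 (w 0) = w' 1" "av \<sigma>1 (z 0 1) = z 1 1"
      using matesD(5)[OF w, of 0] matesD(4)[OF w, of 1] matesD(5)[OF z1, of 0] matesD(3)[OF z1, of 1]
      by (simp_all add: algebra_simps)
    then have "P.equiv_mod (?e (w 0) + ?e (w' 1) - ?e (w' 1)) (?e (z 0 1) + ?e (z 1 1) - (?e (w' 0) + R))"
      using pair1[of "w 0" "z 0 1"] matesD(1)[OF w] matesD(1)[OF z1] step[OF mates_sym[OF w], of 0]
      by (intro P.equiv_diff) auto
    then show ?thesis
      by (simp add: P.equiv_mod_def R_def T_def algebra_simps)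
  qed
  \<comment> \<open>The hypothesis \<open>1 \<le> s\<close> enters here: the rotation orbit of \<open>w\<close> is compared with that of a fixed \<open>z\<close>,
    for which \<open>n\<close> times a vertex is \<open>h\<close> times twice a vertex.\<close>
  have n_mult: "P.equiv_mod (of_int (int n) * ?e (w 0)) (of_int (int h) * T)" if w: "mates w w'" for w w'
  proof -
    have lin: "P.equiv_mod (\<Sum>i=1..int n. ?e (u i)) (of_int (int n) * ?e (u 0) + of_int (\<Sum>i=1..int n. i) * R)"
      if "mates u u'" for u u'
      using P.weighted_progression_equiv[of "\<lambda>i. ?e (u i)" R "\<lambda>i. 1" n, OF step[OF that]] by simp
    \<comment> \<open>Both rotation sums contain the same multiple of \<open>R\<close>, which
      cancels.\<close>
    have "P.equiv_mod (of_int (int n) * ?e (w 0) + of_int (\<Sum>i=1..int n. i) * R)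
        (of_int (int n) * ?e (z 0 1) + of_int (\<Sum>i=1..int n. i) * R)"
      using P.equiv_trans[OF P.equiv_trans[OF P.equiv_sym[OF lin[OF w]] rot[OF w]] lin[OF z1]] .
    then show ?thesis
      by (simp add: P.equiv_mod_def T_def h algebra_simps)
  qed
  define S M B where "S w = (\<Sum>i=1..int n. \<delta> (w i))" and "M w = (\<Sum>i=1..int n. i * \<delta> (w i))"
    and "B w = (\<Sum>i=1..int n. of_int (\<delta> (w i)) * ?e (w i))" for w
  have block: "P.equiv_mod (B w) (of_int (S w) * ?e (w 0) + of_int (M w) * R)" if "mates w w'" for w w'
    unfolding S_def M_def B_def using P.weighted_progression_equiv[where w = "\<lambda>i. ?e (w i)", OF step[OF that]] .
  \<comment> \<open>Condition (3) lets the copies of \<open>z 0 j\<close> be grouped in pairs, each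
    congruent to \<open>T\<close>; \<open>k\<close> counts the pairs.\<close>
  have "\<exists>k. 2 * k = S (\<lambda>i. z i j) \<and> P.equiv_mod (B (\<lambda>i. z i j)) (of_int k * T + of_int (M (\<lambda>i. z i j)) * R)"
    if j: "j \<in> {1..s}" for j
  proof -
    have "even (S (\<lambda>i. z i j))"
      using crit j by (auto simp: criterion_def cong_0_iff S_def)
    then obtain k where k: "S (\<lambda>i. z i j) = 2 * k"
      by blast
    have "of_int (2 * k) * ?e (z 0 j) = of_int k * (?e (z 0 j) + ?e (z 0 j))"
      by (simp add: algebra_simps)
    then have "P.equiv_mod (B (\<lambda>i. z i j)) (of_int k * (?e (z 0 j) + ?e (z 0 j)) + of_int (M (\<lambda>i. z i j)) * R)"
      using block[OF mates_z[OF j]] unfolding k by (simp only:)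
    also have "P.equiv_mod \<dots> (of_int k * T + of_int (M (\<lambda>i. z i j)) * R)"
      by (intro P.equiv_add P.equiv_scale sum_mates[OF mates_z[OF j]] P.equiv_refl)
    finally show ?thesis
      using k by auto
  qed
  then obtain kz where kz: "\<And>j. j \<in> {1..s} \<Longrightarrow> 2 * kz j = S (\<lambda>i. z i j)"
    "\<And>j. j \<in> {1..s} \<Longrightarrow> P.equiv_mod (B (\<lambda>i. z i j)) (of_int (kz j) * T + of_int (M (\<lambda>i. z i j)) * R)"
    by metis
  have "\<exists>k. 2 * k = S (\<lambda>i. x i j) + S (\<lambda>i. y i j)
      \<and> P.equiv_mod (B (\<lambda>i. x i j) + B (\<lambda>i. y i j)) (of_int k * T + of_int (M (\<lambda>i. x i j) + M (\<lambda>i. y i j)) * R)"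
    if j: "j \<in> {1..t}" for j
  proof -
    let ?x = "\<lambda>i. x i j" and ?y = "\<lambda>i. y i j"
    \<comment> \<open>By condition (2), \<open>S ?y\<close> pairs \<open>x 0 j + y 0 j\<close> leave
      \<open>n m\<close> spare copies of \<open>x 0 j\<close>, worth \<open>m h\<close> times
      \<open>T\<close>. As \<open>n = 2 h\<close>, the coefficient \<open>S ?y + m h\<close> is half
      the total of the two rows.\<close>
    have "int n dvd S ?x - S ?y"
      using crit j by (auto simp: criterion_def cong_iff_dvd_diff S_def)
    then obtain m where "S ?x - S ?y = int n * m"
      by blast
    then have m: "S ?x = S ?y + int n * m"
      by simp
    have "P.equiv_mod (B ?x + B ?y)
        ((of_int (S ?x) * ?e (?x 0) + of_int (M ?x) * R) + (of_int (S ?y) * ?e (?y 0) + of_int (M ?y) * R))"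
      using j by (intro P.equiv_add block[OF mates_xy] block[OF mates_sym[OF mates_xy]])
    also have "(of_int (S ?x) * ?e (?x 0) + of_int (M ?x) * R) + (of_int (S ?y) * ?e (?y 0) + of_int (M ?y) * R)
        = of_int (S ?y) * (?e (?x 0) + ?e (?y 0)) + of_int m * (of_int (int n) * ?e (?x 0)) + of_int (M ?x + M ?y) * R"
      unfolding m by (simp add: algebra_simps)
    also have "P.equiv_mod \<dots> (of_int (S ?y) * T + of_int m * (of_int (int h) * T) + of_int (M ?x + M ?y) * R)"
      using j by (intro P.equiv_add P.equiv_scale sum_mates[OF mates_xy] n_mult[OF mates_xy] P.equiv_refl)
    also have "of_int (S ?y) * T + of_int m * (of_int (int h) * T) + of_int (M ?x + M ?y) * R
        = of_int (S ?y + m * int h) * T + of_int (M ?x + M ?y) * R"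
      by (simp add: distrib_right mult.assoc)
    finally have "P.equiv_mod (B ?x + B ?y) (of_int (S ?y + m * int h) * T + of_int (M ?x + M ?y) * R)" .
    moreover have "2 * (S ?y + m * int h) = S ?x + S ?y"
      using m h by simp
    ultimately show ?thesis
      by blast
  qed
  then obtain kxy where kxy: "\<And>j. j \<in> {1..t} \<Longrightarrow> 2 * kxy j = S (\<lambda>i. x i j) + S (\<lambda>i. y i j)"
    "\<And>j. j \<in> {1..t} \<Longrightarrow> P.equiv_mod (B (\<lambda>i. x i j) + B (\<lambda>i. y i j))
      (of_int (kxy j) * T + of_int (M (\<lambda>i. x i j) + M (\<lambda>i. y i j)) * R)"
    by metis
  let ?k = "(\<Sum>j=1..s. kz j) + (\<Sum>j=1..t. kxy j)"
  let ?W = "(\<Sum>j=1..s. M (\<lambda>i. z i j)) + (\<Sum>j=1..t. M (\<lambda>i. x i j) + M (\<lambda>i. y i j))"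
  \<comment> \<open>Every coefficient of \<open>T\<close> is half a row total, so together they make
    half the degree, which is zero.\<close>
  have "2 * ?k = sum \<delta> (verts G)"
    unfolding sum_verts distrib_left sum_distrib_left using kz(1) kxy(1) by (simp add: S_def)
  then have k: "?k = 0"
    using deg by (simp add: div_degree_def)
  \<comment> \<open>Condition (1): the coefficient of \<open>R\<close> is a multiple of
    \<open>n\<close>, and \<open>nR\<close> kills that term.\<close>
  have "int n dvd ?W"
    using crit unfolding criterion_def sum_moments by (simp add: M_def cong_0_iff)
  then obtain q where q: "?W = int n * q"
    by blast
  let ?B = "(\<Sum>j=1..s. B (\<lambda>i. z i j)) + (\<Sum>j=1..t. B (\<lambda>i. x i j) + B (\<lambda>i. y i j))"
  have "\<delta> = (\<Sum>v\<in>verts G. of_int (\<delta> v) * ?e v)"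
    using \<delta> finite_verts by (intro sum_point_divisors[symmetric]) (auto simp: divisors_def)
  then have \<delta>_B: "\<delta> = ?B"
    unfolding sum_verts B_def .
  have "(\<Sum>j=1..s. of_int (kz j) * T + of_int (M (\<lambda>i. z i j)) * R)
      + (\<Sum>j=1..t. of_int (kxy j) * T + of_int (M (\<lambda>i. x i j) + M (\<lambda>i. y i j)) * R)
      = of_int ?k * T + of_int ?W * R"
    by (simp only: of_int_add of_int_sum sum.distrib sum_distrib_right distrib_right add_ac)
  also have "\<dots> = of_int q * (of_int (int n) * R)"
    unfolding k q by (simp only: of_int_0 mult_zero_left add_0_left of_int_mult mult_ac)
  finally have total: "(\<Sum>j=1..s. of_int (kz j) * T + of_int (M (\<lambda>i. z i j)) * R)
      + (\<Sum>j=1..t. of_int (kxy j) * T + of_int (M (\<lambda>i. x i j) + M (\<lambda>i. y i j)) * R)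
      = of_int q * (of_int (int n) * R)" .
  have "P.equiv_mod ?B (of_int q * (of_int (int n) * R))"
    unfolding total[symmetric]
    by (rule P.equiv_add[OF P.equiv_sum[OF kz(2)] P.equiv_sum[OF kxy(2)]])
  then have "P.equiv_mod ?B (of_int q * 0)"
    by (rule P.equiv_trans) (rule P.equiv_scale[OF nR])
  then have "?B \<in> ?P"
    by (simp only: P.equiv_mod_def mult_zero_right diff_0_right)
  then show ?thesis
    by (simp only: \<delta>_B[symmetric])
qed

end

theorem theorem3p4:
  fixes G :: "('v, 'e) multigraph" and A :: "'g monoid"
    and av :: "'g \<Rightarrow> 'v \<Rightarrow> 'v" and ae :: "'g \<Rightarrow> 'e \<Rightarrow> 'e"
    and n s t :: nat and \<sigma>1 \<sigma>2 :: 'g and z x y :: "int \<Rightarrow> nat \<Rightarrow> 'v"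
    and \<delta> :: "'v \<Rightarrow> int"
  assumes "labelled_dihedral_action G A av ae n \<sigma>1 \<sigma>2 s t z x y"
    and "even n"
    and "1 \<le> s"
    and "\<delta> \<in> divisors G"
    and "div_degree G \<delta> = 0"
  shows "\<delta> \<in> sum3 (pullbacks0 G (subgroup_generated_by A \<sigma>1) av ae)
                   (pullbacks0 G (subgroup_generated_by A \<sigma>2) av ae)
                   (pullbacks0 G (subgroup_generated_by A (\<sigma>1 \<otimes>\<^bsub>A\<^esub> \<sigma>2)) av ae)
    \<longleftrightarrow>
      [(\<Sum>i = 1..int n. i * ((\<Sum>j = 1..t. \<delta> (x i j)) + (\<Sum>j = 1..t. \<delta> (y i j))
                              + (\<Sum>j = 1..s. \<delta> (z i j)))) = 0] (mod int n)
      \<and> (\<forall>j \<in> {1..t}. [(\<Sum>i = 1..int n. \<delta> (x i j)) = (\<Sum>i = 1..int n. \<delta> (y i j))] (mod int n))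
      \<and> (\<forall>j \<in> {1..s}. [(\<Sum>i = 1..int n. \<delta> (z i j)) = 0] (mod 2))"
proof -
  interpret labelled_dihedral_action G A av ae n \<sigma>1 \<sigma>2 s t z x y
    by (rule assms(1))
  have "\<delta> \<in> sum3 (pullbacks0 G (cyclic \<sigma>1) av ae) (pullbacks0 G (cyclic \<sigma>2) av ae)
      (pullbacks0 G (cyclic rotation) av ae) \<longleftrightarrow> criterion \<delta>"
  proof
    assume "criterion \<delta>"
    with assms(2-5) show "\<delta> \<in> sum3 (pullbacks0 G (cyclic \<sigma>1) av ae) (pullbacks0 G (cyclic \<sigma>2) av ae)
        (pullbacks0 G (cyclic rotation) av ae)"
      by (rule criterion_imp_sum_of_pullbacks)
  next
    assume "\<delta> \<in> sum3 (pullbacks0 G (cyclic \<sigma>1) av ae) (pullbacks0 G (cyclic \<sigma>2) av ae)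
        (pullbacks0 G (cyclic rotation) av ae)"
    then obtain d1 d2 d3 where d: "\<delta> = (\<lambda>v. d1 v + d2 v + d3 v)"
      "d1 \<in> pullbacks0 G (cyclic \<sigma>1) av ae" "d2 \<in> pullbacks0 G (cyclic \<sigma>2) av ae"
      "d3 \<in> pullbacks0 G (cyclic rotation) av ae"
      unfolding sum3_def by auto
    show "criterion \<delta>"
      unfolding d(1) using d(2-4) assms(2)
      by (intro criterion_add criterion_pullbacks0_sigma1 criterion_pullbacks0_sigma2
          criterion_pullbacks0_rotation)
  qed
  then show ?thesis
    unfolding criterion_def column_sum_def .
qed

end
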